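(* Suppose $f\in C^{1,1}_L(\mathbb{R}^d)$ is bounded below by $f^*=\inf_x f(x)$. Consider the gAEGD update rule with $\hat F:\mathbb{R}^+\to\mathbb{R}^+$ smooth, strictly increasing with $\lim_{s\to\infty}\hat F(s)=\infty$, and strictly concave with $\lim_{s\to\infty}\hat F'(s)=0$. Then for any $\eta>0$ and $r_0>0$, if the parameter $c$ is chosen such that $c\ge c^*$, where $$c^*=\min_{a\in(0,1)}\max\left\{(\hat F')^{-1}\!\left(\frac{a r_0}{f_0-f^*}\right),\ \hat F^{-1}\!\left(\frac{L\eta r_0}{4(1-a)}\right)\right\}-f^*,\qquad f_0=f(x_0),$$ then for any $\epsilon>0$ the gradient norm satisfies $$\min_{k\le N}\|\nabla f(x_k)\|^2<\epsilon$$ after at most $N$ iterations, with $$N=\left\lceil \frac1\epsilon\left[\frac{2\bar F(f_0-f^* )}{\eta r^*}\right]\right\rceil\quad\text{if } r_0\le\frac{F^*}{L\eta},$$ $$N=\left\lceil \max\left\{\frac{\ln\!\left(\frac{L r_0\eta}{F^*}\right)}{\ln(1+\underline{\alpha}\,\eta\,\epsilon)},\,1\right\}+\frac1\epsilon\left[\frac{2\bar F(\bar f-f^* )}{\eta r^*}\right]\right\rceil\quad\text{if } r_0>\frac{F^*}{L\eta}.$$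
   Context: $\mathbb{R}^+=(0,\infty)$ and $\|\cdot\|$ is the Euclidean norm. $C^{1,1}_L(\mathbb{R}^d)$ is the class of differentiable functions on $\mathbb{R}^d$ whose gradient is $L$-Lipschitz. The gAEGD update rule: given $x_0\in\mathbb{R}^d$, $r_0>0$, $\eta>0$ and $c\in\mathbb{R}$ with $f^*+c>0$, for $k\ge 0$ put $F_k=\hat F(f(x_k)+c)$, $F'_k=\hat F'(f(x_k)+c)$, and $$r_{k+1}=\frac{r_k}{1+\eta\frac{F'_k}{F_k}\|\nabla f(x_k)\|^2},\qquad x_{k+1}=x_k-\eta\frac{r_{k+1}}{F_k}\nabla f(x_k).$$ $r^*=\lim_{k\to\infty}r_k=\inf_k r_k$. Constants: $F^*=\hat F(f^*+c)$; $\bar F=F_0+\frac{L\eta r_0^2}{4F^*}$; $\bar f=\hat F^{-1}(\bar F)-c$; $\bar F'=\hat F'(\bar f+c)$; $\underline{\alpha}=\bar F'/\bar F$. $(\hat F')^{-1}$ and $\hat F^{-1}$ denote the inverse functions of $\hat F'$ and $\hat F$. *)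

theory Defs
  imports "HOL-Analysis.Analysis"
begin

definition grad :: "(real ^ 'd \<Rightarrow> real) \<Rightarrow> real ^ 'd \<Rightarrow> real ^ 'd" where
  "grad f x = (THE D. GDERIV f x :> D)"

definition C11 :: "real \<Rightarrow> (real ^ 'd \<Rightarrow> real) set" where
  "C11 L = {f. (\<forall>x. f differentiable (at x)) \<and> L-lipschitz_on UNIV (grad f)}"

(* Only meaningful for open S: existence of all iterated derivatives on S
   then already makes each of them continuous on S. *)
definition smooth_on :: "real set \<Rightarrow> (real \<Rightarrow> real) \<Rightarrow> bool" where
  "smooth_on S F \<longleftrightarrow> (\<forall>n. \<forall>s\<in>S. (deriv ^^ n) F differentiable (at s))"

definition strictly_concave_on :: "real set \<Rightarrow> (real \<Rightarrow> real) \<Rightarrow> bool" where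
  "strictly_concave_on S F \<longleftrightarrow> convex S \<and>
     (\<forall>s\<in>S. \<forall>t\<in>S. \<forall>u\<in>{0<..<1}. s \<noteq> t \<longrightarrow>
        F ((1 - u) * s + u * t) > (1 - u) * F s + u * F t)"

(* Inverse function of the restriction of g to (0, infinity), extended by 0 off the range.
   It is applied to g = F and to g = F'.  The range of F is (F(0+), infinity) and that of F'
   is (0, F'(0+)), so a positive y off the range satisfies y <= F(0+), respectively
   y >= F'(0+), and 0 is the value of the generalised inverses Inf {s > 0. F s >= y} and
   Inf {s > 0. F' s <= y}. *)
definition pos_inverse :: "(real \<Rightarrow> real) \<Rightarrow> real \<Rightarrow> real" where
  "pos_inverse g y = (if y \<in> g ` {0<..} then the_inv_into {0<..} g y else 0)"

definition gAEGD ::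
  "(real ^ 'd \<Rightarrow> real) \<Rightarrow> (real \<Rightarrow> real) \<Rightarrow> real \<Rightarrow> real \<Rightarrow> (nat \<Rightarrow> real ^ 'd) \<Rightarrow> (nat \<Rightarrow> real) \<Rightarrow> bool" where
  "gAEGD f F \<eta> c x r \<longleftrightarrow> (\<forall>k.
     r (Suc k) = r k / (1 + \<eta> * (deriv F (f (x k) + c) / F (f (x k) + c)) * (norm (grad f (x k)))\<^sup>2) \<and>
     x (Suc k) = x k - (\<eta> * (r (Suc k) / F (f (x k) + c))) *\<^sub>R grad f (x k))"

(* For L > 0 and f x0 > inf f the infimum over a is attained.  If f x0 = inf f, the quotient
   a * r0 / (f x0 - inf f) should be read as infinity; in HOL it is 0, which is likewise off the
   range of F', so that the first entry of the maximum is 0 under either reading. *)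
definition c_star ::
  "(real ^ 'd \<Rightarrow> real) \<Rightarrow> (real \<Rightarrow> real) \<Rightarrow> real \<Rightarrow> real \<Rightarrow> real \<Rightarrow> real ^ 'd \<Rightarrow> real" where
  "c_star f F L \<eta> r0 x0 =
     (INF a\<in>{0<..<1}. max (pos_inverse (deriv F) (a * r0 / (f x0 - (INF x. f x))))
                          (pos_inverse F (L * \<eta> * r0 / (4 * (1 - a)))))
     - (INF x. f x)"

end

theory Submission
  imports Defs
begin

text \<open>
  Concavity of \<open>F\<close> and the descent lemma give
  \<open>F\<^sub>k\<^sub>+\<^sub>1 \<le> F\<^sub>k - (r\<^sub>k - r\<^sub>k\<^sub>+\<^sub>1) + (L \<eta> / (4 F*)) (r\<^sub>k\<^sup>2 - r\<^sub>k\<^sub>+\<^sub>1\<^sup>2)\<close>, because the gradient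
  term of the descent lemma is exactly the decrement of \<open>r\<close>. The right-hand side telescopes: it bounds
  \<open>F\<^sub>k\<close> by \<open>Fbar\<close> and, for \<open>c \<ge> c*\<close>, keeps \<open>r\<close> above a positive constant,
  unless \<open>f\<^sub>0 = f*\<close>, in which case the first gradient vanishes.
  As soon as \<open>r\<^sub>k \<le> F* / (L \<eta>)\<close>, each step decreases \<open>f\<close> by at least
  \<open>\<eta> r* / (2 Fbar)\<close> times the squared gradient norm, so that at most \<open>2 Fbar (f\<^sub>k - f*) / (\<eta> r* \<epsilon>)\<close>
  of the following gradients are large. While the gradients are large, \<open>r\<close> decays geometrically with ratio
  \<open>1 / (1 + \<alpha> \<eta> \<epsilon>)\<close>, which bounds the time needed to get there.
\<close>

section \<open>Gradients and the descent lemma\<close>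

text \<open>A derivative is a linear functional, hence the inner product with the vector
  \<open>D\<close> of its values on the basis. Uniqueness of derivatives then makes the
  \<open>THE\<close> in \<open>grad\<close> well defined.\<close>

lemma GDERIV_grad:
  assumes "f differentiable (at x)"
  shows "GDERIV f x :> grad f x"
proof -
  obtain f' where f': "(f has_derivative f') (at x)"
    using assms unfolding differentiable_def by blast
  have lin: "linear f'"
    using f' has_derivative_linear by blast
  define D where "D = (\<Sum>b\<in>Basis. f' b *\<^sub>R b)"
  have "f' = (\<lambda>h. h \<bullet> D)"
  proof
    fix h
    have "f' h = f' (\<Sum>b\<in>Basis. (h \<bullet> b) *\<^sub>R b)"
      by (simp add: euclidean_representation)
    also have "\<dots> = (\<Sum>b\<in>Basis. (h \<bullet> b) *\<^sub>R f' b)"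
      using lin by (simp add: linear_sum linear_scale)
    also have "\<dots> = h \<bullet> D"
      by (simp add: D_def inner_sum_right mult.commute)
    finally show "f' h = h \<bullet> D" .
  qed
  then have D: "GDERIV f x :> D"
    using f' by (simp add: gderiv_def)
  have "E = D" if "GDERIV f x :> E" for E
  proof -
    have "(\<lambda>h. h \<bullet> E) = (\<lambda>h. h \<bullet> D)"
      using that D has_derivative_unique unfolding gderiv_def by blast
    then show ?thesis
      by (metis inner_commute vector_eq_rdot)
  qed
  with D show ?thesis
    unfolding grad_def by (rule theI)
qed

text \<open>Along the segment, \<open>f\<close> minus the quadratic majorant has nonpositive
  derivative, by Cauchy-Schwarz and the Lipschitz bound on the gradient.\<close>

lemma C11_descent:
  assumes f: "f \<in> C11 L"
  shows "f (x + d) \<le> f x + d \<bullet> grad f x + L / 2 * (norm d)\<^sup>2"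
proof -
  define \<phi> where "\<phi> t = f (x + t *\<^sub>R d) - t * (d \<bullet> grad f x) - L / 2 * t\<^sup>2 * (norm d)\<^sup>2" for t
  have "\<phi> 1 \<le> \<phi> 0"
  proof (rule DERIV_nonpos_imp_nonincreasing[where f = \<phi>])
    fix t :: real assume t: "0 \<le> t" "t \<le> 1"
    let ?y = "x + t *\<^sub>R d"
    have f_der: "(f has_derivative (\<lambda>h. h \<bullet> grad f ?y)) (at ?y)"
      using GDERIV_grad[of f ?y] f unfolding C11_def gderiv_def by blast
    have line_der: "((\<lambda>t. x + t *\<^sub>R d) has_derivative (\<lambda>h. h *\<^sub>R d)) (at t)"
      by (auto intro!: derivative_eq_intros)
    have "((\<lambda>t. f (x + t *\<^sub>R d)) has_derivative (\<lambda>h. (h *\<^sub>R d) \<bullet> grad f ?y)) (at t)"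
      by (rule has_derivative_compose[OF line_der f_der])
    then have "((\<lambda>t. f (x + t *\<^sub>R d)) has_real_derivative d \<bullet> grad f ?y) (at t)"
      by (rule has_derivative_imp_has_field_derivative) simp
    then have der: "(\<phi> has_real_derivative d \<bullet> grad f ?y - d \<bullet> grad f x - L * t * (norm d)\<^sup>2) (at t)"
      unfolding \<phi>_def by (auto intro!: derivative_eq_intros)
    have "d \<bullet> grad f ?y - d \<bullet> grad f x \<le> norm d * norm (grad f ?y - grad f x)"
      by (metis inner_diff_right norm_cauchy_schwarz)
    also have "\<dots> \<le> norm d * (L * norm (t *\<^sub>R d))"
      using f lipschitz_onD[of L UNIV "grad f" ?y x] unfolding C11_def
      by (intro mult_left_mono) (auto simp: dist_norm)
    finally have "d \<bullet> grad f ?y - d \<bullet> grad f x \<le> L * t * (norm d)\<^sup>2"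
      using t by (simp add: power2_eq_square algebra_simps)
    with der show "\<exists>y. (\<phi> has_real_derivative y) (at t) \<and> y \<le> 0"
      by (intro exI conjI) auto
  qed auto
  then show ?thesis
    by (simp add: \<phi>_def)
qed

lemma C11_descent_step:
  assumes "f \<in> C11 L"
  shows "f (x - t *\<^sub>R grad f x) \<le> f x - t * (1 - L * t / 2) * (norm (grad f x))\<^sup>2"
  using C11_descent[OF assms, of x "- t *\<^sub>R grad f x"]
  by (simp add: power_mult_distrib dot_square_norm)
    (simp add: algebra_simps power2_eq_square)

text \<open>A gradient step of length \<open>1 / L\<close> lowers \<open>f\<close> by at least the
  squared gradient norm over \<open>2 * L\<close>, which is impossible at a minimum.\<close>

lemma C11_grad_eq_0_at_min:
  assumes f: "f \<in> C11 L" and L: "L > 0" and min: "\<And>y. f x \<le> f y"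
  shows "grad f x = 0"
proof -
  have "f x \<le> f x - 1 / L * (1 - L * (1 / L) / 2) * (norm (grad f x))\<^sup>2"
    using min C11_descent_step[OF f] order_trans by blast
  then have "1 / (2 * L) * (norm (grad f x))\<^sup>2 \<le> 0"
    using L by simp
  then show ?thesis
    using L by (simp add: divide_le_0_iff)
qed

section \<open>Concave functions and inverse functions of one real variable\<close>

lemma smooth_on_DERIV:
  assumes "smooth_on S F" "s \<in> S"
  shows "(F has_real_derivative deriv F s) (at s)"
proof -
  have "F differentiable (at s)"
    using assms unfolding smooth_on_def by (metis funpow_0)
  then show ?thesis
    using DERIV_deriv_iff_real_differentiable by blast
qed

lemma smooth_on_imp_continuous_on:
  "smooth_on S F \<Longrightarrow> continuous_on S F"
  by (meson DERIV_isCont continuous_at_imp_continuous_on smooth_on_DERIV)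

lemma smooth_on_deriv: "smooth_on S F \<Longrightarrow> smooth_on S (deriv F)"
  unfolding smooth_on_def by (metis comp_apply funpow_Suc_right)

lemma strictly_concave_on_tangent_less:
  assumes conc: "strictly_concave_on S F" and S: "open S" "s \<in> S" "t \<in> S" and ne: "s \<noteq> t"
    and der: "(F has_real_derivative D) (at s)"
  shows "F t < F s + D * (t - s)"
proof -
  have conv: "convex S"
    using conc unfolding strictly_concave_on_def by blast
  have tangent: "F u \<le> F s + D * (u - s)" if "u \<in> S" for u
  proof -
    have "convex_on S (\<lambda>u. - F u)"
    proof (intro convex_onI conv)
      fix v a b :: real assume "0 < v" "v < 1" and ab: "a \<in> S" "b \<in> S"
      then have "a \<noteq> b \<Longrightarrow> F ((1 - v) * a + v * b) > (1 - v) * F a + v * F b"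
        using conc unfolding strictly_concave_on_def by auto
      then show "- F ((1 - v) *\<^sub>R a + v *\<^sub>R b) \<le> (1 - v) * - F a + v * - F b"
        by (cases "a = b") (auto simp: algebra_simps)
    qed
    moreover have "((\<lambda>u. - F u) has_real_derivative - D) (at s within S)"
      using der by (auto intro!: derivative_eq_intros intro: DERIV_subset)
    ultimately have "- F u - - F s \<ge> - D * (u - s)"
      using convex_on_imp_above_tangent convex_connected[OF conv] S that
      by (metis interior_open)
    then show ?thesis by simp
  qed
  \<comment> \<open>Convexity of \<open>- F\<close> gives only the weak inequality. Strictness comes
    from the midpoint: \<open>F m\<close> lies strictly above the chord but not above the
    tangent.\<close>
  define m where "m = (1 - 1/2) * s + (1/2) * t"
  have "m \<in> S"
    using convexD_alt[OF conv S(2,3), of "1/2"] by (simp add: m_def)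
  then have "F m \<le> F s + D * (m - s)"
    by (rule tangent)
  moreover have "F m > (1 - 1/2) * F s + (1/2) * F t"
    using conc S ne unfolding strictly_concave_on_def m_def by fastforce
  ultimately show ?thesis
    by (simp add: m_def field_simps)
qed

lemma pos_inverse_eq:
  assumes "inj_on g {0<..}" "0 < u" "g u = y"
  shows "pos_inverse g y = u"
  using assms the_inv_into_f_f[of g "{0<..}" u] unfolding pos_inverse_def by auto

text \<open>The default value 0 of \<open>pos_inverse\<close> does no harm here: if
  \<open>g t < y\<close>, then the limit and the intermediate value theorem put \<open>y\<close>
  into the range, attained at some \<open>u\<close> with \<open>t \<le> u\<close>.\<close>

lemma le_of_pos_inverse_less:
  assumes inj: "inj_on g {0<..}" and cont: "continuous_on {0<..} g"
    and lim: "filterlim g at_top at_top" and t: "0 < t" "pos_inverse g y < t"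
  shows "y \<le> g t"
proof (rule ccontr)
  assume "\<not> y \<le> g t"
  moreover have "\<forall>\<^sub>F s in at_top. y \<le> g s \<and> t \<le> s"
    using lim by (auto simp: filterlim_at_top eventually_conj_iff)
  then obtain s where "y \<le> g s" "t \<le> s"
    using eventually_happens trivial_limit_at_top_linorder by blast
  moreover have "continuous_on {t..s} g"
    using t by (intro continuous_on_subset[OF cont]) auto
  ultimately obtain u where "t \<le> u" "g u = y"
    using IVT'[of g t y s] by auto
  then have "pos_inverse g y = u"
    using pos_inverse_eq[OF inj, of u y] t by simp
  with t \<open>t \<le> u\<close> show False by simp
qed

text \<open>Mirror image for functions tending to 0; \<open>0 < y\<close> ensures that
  \<open>g\<close> eventually falls below \<open>y\<close>.\<close>

lemma ge_of_pos_inverse_less: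
  assumes inj: "inj_on g {0<..}" and cont: "continuous_on {0<..} g"
    and lim: "(g \<longlongrightarrow> 0) at_top" and y: "0 < y" and t: "0 < t" "pos_inverse g y < t"
  shows "g t \<le> y"
proof (rule ccontr)
  assume "\<not> g t \<le> y"
  moreover have "\<forall>\<^sub>F s in at_top. g s < y \<and> t \<le> s"
    using order_tendstoD(2)[OF lim y] by (auto simp: eventually_conj_iff eventually_ge_at_top)
  then obtain s where "g s < y" "t \<le> s"
    using eventually_happens trivial_limit_at_top_linorder by blast
  moreover have "continuous_on {t..s} g"
    using t by (intro continuous_on_subset[OF cont]) auto
  ultimately obtain u where "t \<le> u" "g u = y"
    using IVT2'[of g s y t] by auto
  then have "pos_inverse g y = u"
    using pos_inverse_eq[OF inj, of u y] t by simp
  with t \<open>t \<le> u\<close> show False by simp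
qed

section \<open>The iteration: signs and monotonicity\<close>

locale gAEGD_run =
  fixes f :: "real ^ 'd \<Rightarrow> real" and F :: "real \<Rightarrow> real"
    and x :: "nat \<Rightarrow> real ^ 'd" and r :: "nat \<Rightarrow> real" and L \<eta> c fstar Fstar Fbar :: real
  assumes L: "L > 0" and f: "f \<in> C11 L" and f_bdd: "bdd_below (range f)"
    and F_pos: "F \<in> {0<..} \<rightarrow> {0<..}" and F_smooth: "smooth_on {0<..} F"
    and F_mono: "strict_mono_on {0<..} F" and F_lim: "filterlim F at_top at_top"
    and F_concave: "strictly_concave_on {0<..} F" and F'_lim: "(deriv F \<longlongrightarrow> 0) at_top"
    and \<eta>: "\<eta> > 0" and r0: "r 0 > 0"
    and fstar: "fstar = (INF y. f y)" and c_pos: "fstar + c > 0"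
    and c: "c \<ge> c_star f F L \<eta> (r 0) (x 0)"
    and iter: "gAEGD f F \<eta> c x r"
    and Fstar: "Fstar = F (fstar + c)"
    and Fbar: "Fbar = F (f (x 0) + c) + L * \<eta> * (r 0)\<^sup>2 / (4 * Fstar)"
begin

abbreviation s :: "nat \<Rightarrow> real" where "s k \<equiv> f (x k) + c"
abbreviation g :: "nat \<Rightarrow> real" where "g k \<equiv> (norm (grad f (x k)))\<^sup>2"

lemma fstar_le: "fstar \<le> f y"
  unfolding fstar using f_bdd by (simp add: cINF_lower)

lemma s_ge: "s k \<ge> fstar + c"
  using fstar_le by simp

lemma s_pos: "s k > 0"
  using s_ge c_pos by (rule less_le_trans[rotated])

lemma F_le_iff: "0 < a \<Longrightarrow> 0 < b \<Longrightarrow> F a \<le> F b \<longleftrightarrow> a \<le> b"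
  using strict_mono_on_less_eq[OF F_mono] by auto

lemma F_tangent_less: "0 < a \<Longrightarrow> 0 < b \<Longrightarrow> a \<noteq> b \<Longrightarrow> F b < F a + deriv F a * (b - a)"
  using strictly_concave_on_tangent_less[OF F_concave, of a b "deriv F a"] smooth_on_DERIV[OF F_smooth]
  by simp

lemma F_tangent: "0 < a \<Longrightarrow> 0 < b \<Longrightarrow> F b \<le> F a + deriv F a * (b - a)"
  using F_tangent_less[of a b] by (cases "a = b") auto

text \<open>Adding the strict tangent inequalities at \<open>a\<close> and at \<open>b\<close>
  cancels the values of \<open>F\<close>.\<close>

lemma F'_less:
  assumes "0 < a" "a < b"
  shows "deriv F b < deriv F a"
proof -
  have "F b < F a + deriv F a * (b - a)" "F a < F b + deriv F b * (a - b)"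
    using assms by (intro F_tangent_less; simp)+
  then have "(deriv F a - deriv F b) * (b - a) > 0"
    by (simp add: algebra_simps)
  then show ?thesis
    using assms by (simp add: zero_less_mult_iff)
qed

lemma F'_antimono: "0 < a \<Longrightarrow> a \<le> b \<Longrightarrow> deriv F b \<le> deriv F a"
  using F'_less[of a b] by (cases "a = b") auto

text \<open>Monotonicity alone would allow a zero derivative; by concavity, \<open>deriv F a\<close>
  is at least the increment \<open>F (a + 1) - F a\<close>, which is positive.\<close>

lemma F'_pos: "0 < a \<Longrightarrow> 0 < deriv F a"
  using F_tangent[of a "a + 1"] F_le_iff[of "a + 1" a] by simp

lemma Fstar_pos: "Fstar > 0"
  using F_pos c_pos unfolding Fstar by auto

lemma Fstar_le: "Fstar \<le> F (s k)"
  unfolding Fstar using F_le_iff c_pos s_pos s_ge by blast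

lemma F_s_pos: "F (s k) > 0"
  using Fstar_pos Fstar_le by (rule less_le_trans)

lemma r_Suc: "r (Suc k) = r k / (1 + \<eta> * (deriv F (s k) / F (s k)) * g k)"
  and x_Suc: "x (Suc k) = x k - (\<eta> * (r (Suc k) / F (s k))) *\<^sub>R grad f (x k)"
  using iter unfolding gAEGD_def by auto

lemma rate_nonneg: "0 \<le> \<eta> * (deriv F (s k) / F (s k)) * g k"
  using \<eta> F'_pos[OF s_pos] F_s_pos by (simp add: order.strict_implies_order)

text \<open>Clearing the denominator of the update exhibits the decrement as
  \<open>deriv F (s k)\<close> times the step length times \<open>g k\<close>, the first-order term
  of the descent lemma once it is passed through \<open>F\<close>.\<close>

lemma r_decrement: "r k - r (Suc k) = \<eta> * (r (Suc k) / F (s k)) * deriv F (s k) * g k"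
proof -
  have "r (Suc k) * (1 + \<eta> * (deriv F (s k) / F (s k)) * g k) = r k"
    using r_Suc[of k] rate_nonneg[of k] by simp
  then show ?thesis
    by (simp add: algebra_simps)
qed

lemma r_pos: "r k > 0"
proof (induction k)
  case (Suc k)
  then show ?case
    using rate_nonneg[of k] unfolding r_Suc[of k] by (intro divide_pos_pos) auto
qed (rule r0)

lemma r_Suc_le: "r (Suc k) \<le> r k"
  using r_decrement[of k] r_pos[of "Suc k"] \<eta> F_s_pos[of k] F'_pos[OF s_pos, of k]
  by (smt (verit) divide_pos_pos mult_nonneg_nonneg mult_pos_pos zero_le_power2)

lemma r_decseq: "decseq r"
  using r_Suc_le by (simp add: decseq_Suc_iff)

section \<open>A nonincreasing potential\<close>

lemma f_step:
  "f (x (Suc k)) \<le> f (x k) - \<eta> * (r (Suc k) / F (s k)) * (1 - L * (\<eta> * (r (Suc k) / F (s k))) / 2) * g k"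
  unfolding x_Suc by (rule C11_descent_step[OF f])

lemma F_step:
  "F (s (Suc k)) - r (Suc k) + L * \<eta> / (4 * Fstar) * (r (Suc k))\<^sup>2
    \<le> F (s k) - r k + L * \<eta> / (4 * Fstar) * (r k)\<^sup>2"
proof -
  define \<delta> where "\<delta> = r k - r (Suc k)"
  define \<tau> where "\<tau> = \<eta> * (r (Suc k) / F (s k))"
  have \<delta>: "\<delta> = \<tau> * deriv F (s k) * g k"
    unfolding \<delta>_def \<tau>_def by (rule r_decrement)
  have \<delta>0: "\<delta> \<ge> 0"
    using r_Suc_le by (simp add: \<delta>_def)
  have "F (s (Suc k)) \<le> F (s k) + deriv F (s k) * (f (x (Suc k)) - f (x k))"
    using F_tangent[OF s_pos[of k] s_pos[of "Suc k"]] by simp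
  also have "\<dots> \<le> F (s k) + deriv F (s k) * (- \<tau> * (1 - L * \<tau> / 2) * g k)"
    using f_step[of k] F'_pos[OF s_pos, of k]
    by (intro add_left_mono mult_left_mono) (simp_all add: \<tau>_def)
  also have "\<dots> = F (s k) - \<delta> + L / 2 * \<tau> * \<delta>"
    unfolding \<delta> by (simp add: algebra_simps)
  \<comment> \<open>Replacing \<open>F (s k)\<close> by its lower bound \<open>Fstar\<close> makes
    the coefficient independent of \<open>k\<close>, so that the sum can telescope.\<close>
  also have "L / 2 * \<tau> * \<delta> \<le> L / 2 * (\<eta> * (r (Suc k) / Fstar)) * \<delta>"
    unfolding \<tau>_def using L \<eta> r_pos[of "Suc k"] Fstar_pos Fstar_le[of k] \<delta>0
    by (intro mult_right_mono mult_left_mono divide_left_mono) auto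
  also have "\<dots> = L * \<eta> / (4 * Fstar) * (2 * r (Suc k) * \<delta>)"
    by simp
  \<comment> \<open>The two sides differ by a nonnegative multiple of the square of
    \<open>\<delta>\<close>.\<close>
  also have "\<dots> \<le> L * \<eta> / (4 * Fstar) * ((r k)\<^sup>2 - (r (Suc k))\<^sup>2)"
  proof (intro mult_left_mono)
    have "(r k)\<^sup>2 - (r (Suc k))\<^sup>2 - 2 * r (Suc k) * \<delta> = \<delta>\<^sup>2"
      by (simp add: \<delta>_def power2_eq_square algebra_simps)
    then show "2 * r (Suc k) * \<delta> \<le> (r k)\<^sup>2 - (r (Suc k))\<^sup>2"
      by (smt (verit) zero_le_power2)
  qed (use L \<eta> Fstar_pos in auto)
  finally show ?thesis
    by (simp add: \<delta>_def algebra_simps)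
qed

text \<open>\<open>Fbar\<close> is defined so that the potential starts exactly at
  \<open>Fbar - r 0\<close>.\<close>

lemma F_bound:
  "F (s k) - r k + L * \<eta> / (4 * Fstar) * (r k)\<^sup>2 \<le> Fbar - r 0"
proof (induction k)
  case 0
  then show ?case by (simp add: Fbar)
next
  case (Suc k)
  then show ?case using F_step[of k] by linarith
qed

lemma F_s_le_Fbar: "F (s k) \<le> Fbar"
proof -
  have "r k \<le> r 0"
    using r_decseq by (simp add: decseqD)
  moreover have "0 \<le> L * \<eta> / (4 * Fstar) * (r k)\<^sup>2"
    using L \<eta> Fstar_pos by simp
  ultimately show ?thesis
    using F_bound[of k] by linarith
qed

lemma Fbar_pos: "Fbar > 0"
  using F_s_pos F_s_le_Fbar by (rule less_le_trans)

section \<open>Positivity of the limit of \<open>r\<close>\<close>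

text \<open>
  The infimum in \<^const>\<open>c_star\<close> need not be known to be attained: if the inequality failed at
  \<open>fstar + c\<close>, it would by continuity fail at some larger point, which does exceed the maximum for
  some \<open>a\<close>.
\<close>

lemma c_condition:
  assumes D: "f (x 0) > fstar"
  shows "deriv F (fstar + c) * (f (x 0) - fstar) / r 0 + L * \<eta> * r 0 / (4 * Fstar) \<le> 1"
proof (rule ccontr)
  define D where "D = f (x 0) - fstar"
  define h where "h t = deriv F t * D / r 0 + L * \<eta> * r 0 / (4 * F t)" for t
  have Dpos: "D > 0" using D by (simp add: D_def)
  assume "\<not> ?thesis"
  then have "h (fstar + c) > 1"
    by (simp add: h_def D_def Fstar)
  moreover have "isCont h (fstar + c)"
    unfolding h_def using Fstar_pos r0 c_pos unfolding Fstar
    by (intro continuous_intros DERIV_isCont[OF smooth_on_DERIV[OF F_smooth]]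
          DERIV_isCont[OF smooth_on_DERIV[OF smooth_on_deriv[OF F_smooth]]]) auto
  ultimately have "\<forall>\<^sub>F t in at (fstar + c). h t > 1"
    using isContD order_tendstoD(1) by blast
  then have "\<forall>\<^sub>F t in at_right (fstar + c). h t > 1"
    by (rule filter_leD[OF at_le, rotated]) simp
  then have "\<forall>\<^sub>F t in at_right (fstar + c). h t > 1 \<and> t > fstar + c"
    by (simp add: eventually_conj_iff eventually_at_right_less)
  then obtain t where t: "h t > 1" "t > fstar + c"
    using eventually_happens trivial_limit_at_right_real by blast
  have tpos: "t > 0" using t c_pos by simp
  let ?m = "\<lambda>a. max (pos_inverse (deriv F) (a * r 0 / D)) (pos_inverse F (L * \<eta> * r 0 / (4 * (1 - a))))"
  have "(INF a\<in>{0<..<1}. ?m a) < t"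
    using c t unfolding c_star_def fstar[symmetric] D_def[symmetric] by simp
  then obtain a where a: "0 < a" "a < 1" and m: "?m a < t"
    by (auto dest!: cInf_lessD[rotated])
  have inj: "inj_on (deriv F) {0<..}"
    by (intro linorder_inj_onI) (use F'_less in fastforce)+
  have "deriv F t \<le> a * r 0 / D"
    using m a r0 Dpos tpos
    by (intro ge_of_pos_inverse_less inj smooth_on_imp_continuous_on smooth_on_deriv F_smooth F'_lim) auto
  moreover have "L * \<eta> * r 0 / (4 * (1 - a)) \<le> F t"
    using m tpos
    by (intro le_of_pos_inverse_less strict_mono_on_imp_inj_on F_mono smooth_on_imp_continuous_on
          F_smooth F_lim) auto
  moreover have "F t > 0" using F_pos tpos by auto
  \<comment> \<open>Each entry of the maximum controls one summand of \<open>h t\<close>, and the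
    shares \<open>a\<close> and \<open>1 - a\<close> add up to 1.\<close>
  ultimately have "deriv F t * D / r 0 \<le> a" "L * \<eta> * r 0 / (4 * F t) \<le> 1 - a"
    using a r0 Dpos by (auto simp: field_simps)
  with t show False
    by (simp add: h_def)
qed

text \<open>Inserting \<open>Fstar \<le> F (s k)\<close> into the potential bound leaves
  \<open>Fstar - Fbar + r 0\<close> below every \<open>r k\<close>. This is positive because the
  tangent inequality at \<open>fstar + c\<close> is strict for \<open>f (x 0) > fstar\<close>, while
  \<open>c_condition\<close> bounds the remaining terms by \<open>r 0\<close>.\<close>

lemma r_lower_bound:
  assumes D: "f (x 0) > fstar"
  obtains \<rho> where "\<rho> > 0" "\<And>k. \<rho> \<le> r k"
proof
  show "Fstar - Fbar + r 0 > 0"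
  proof -
    have "F (s 0) < Fstar + deriv F (fstar + c) * (f (x 0) - fstar)"
      using F_tangent_less[OF c_pos s_pos, of 0] D by (simp add: Fstar)
    moreover have "deriv F (fstar + c) * (f (x 0) - fstar) + L * \<eta> * (r 0)\<^sup>2 / (4 * Fstar) \<le> r 0"
      using c_condition[OF D] r0 Fstar_pos by (simp add: field_simps power2_eq_square)
    ultimately show ?thesis
      by (simp add: Fbar)
  qed
  show "Fstar - Fbar + r 0 \<le> r k" for k
  proof -
    have "0 \<le> L * \<eta> / (4 * Fstar) * (r k)\<^sup>2"
      using L \<eta> Fstar_pos by simp
    then show ?thesis
      using F_bound[of k] Fstar_le[of k] by linarith
  qed
qed

lemma r_lim:
  assumes D: "f (x 0) > fstar"
  shows "lim r > 0" and "lim r \<le> r k"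
proof -
  obtain \<rho> where \<rho>: "\<rho> > 0" "\<And>k. \<rho> \<le> r k"
    using r_lower_bound[OF D] by blast
  obtain l where l: "r \<longlonglongrightarrow> l" "\<And>k. l \<le> r k"
    using decseq_convergent[OF r_decseq] \<rho>(2) by blast
  have "\<rho> \<le> l"
    using l(1) \<rho>(2) by (intro LIMSEQ_le_const) auto
  then show "lim r > 0" "lim r \<le> r k"
    using l \<rho> by (auto simp: limI)
qed

section \<open>Decrease of \<open>f\<close> once \<open>r\<close> is small\<close>

lemma f_decrease:
  assumes D: "f (x 0) > fstar" and small: "r k \<le> Fstar / (L * \<eta>)"
  shows "\<eta> * lim r / (2 * Fbar) * g k \<le> f (x k) - f (x (Suc k))"
proof -
  define \<tau> where "\<tau> = \<eta> * (r (Suc k) / F (s k))"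
  have \<tau>: "\<tau> > 0"
    using \<eta> r_pos F_s_pos by (simp add: \<tau>_def)
  have "r (Suc k) * (L * \<eta>) \<le> Fstar"
    using order_trans[OF r_Suc_le small] L \<eta> by (simp add: pos_le_divide_eq)
  \<comment> \<open>This explains the threshold \<open>Fstar / (L * \<eta>)\<close>: below it the
    factor \<open>1 - L * \<tau> / 2\<close> is at least one half.\<close>
  then have "L * \<tau> \<le> 1"
    using Fstar_le[of k] F_s_pos[of k] by (simp add: \<tau>_def divide_le_eq algebra_simps)
  have "\<eta> * lim r / (2 * Fbar) = \<eta> * (lim r / Fbar) * (1 / 2)"
    by simp
  also have "\<dots> \<le> \<tau> * (1 / 2)"
    unfolding \<tau>_def using \<eta> r_lim[OF D] r_pos[of "Suc k"] F_s_pos[of k] F_s_le_Fbar[of k]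
    by (intro mult_left_mono mult_right_mono frac_le) (auto intro: less_imp_le)
  also have "\<dots> \<le> \<tau> * (1 - L * \<tau> / 2)"
    using \<tau> \<open>L * \<tau> \<le> 1\<close> by (intro mult_left_mono) auto
  finally have "\<eta> * lim r / (2 * Fbar) * g k \<le> \<tau> * (1 - L * \<tau> / 2) * g k"
    by (rule mult_right_mono) simp
  then show ?thesis
    using f_step[of k] by (simp add: \<tau>_def)
qed

text \<open>Each large gradient costs a fixed amount of \<open>f\<close>, and only
  \<open>f (x m) - fstar\<close> is available. The starting index \<open>m\<close> is free so that
  the count can also begin after an initial phase.\<close>

lemma count_large_gradients:
  assumes D: "f (x 0) > fstar" and small: "r m \<le> Fstar / (L * \<eta>)"
    and \<epsilon>: "\<epsilon> > 0" and large: "\<And>k. m \<le> k \<Longrightarrow> k < m + n \<Longrightarrow> \<epsilon> \<le> g k"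
  shows "real n \<le> 1 / \<epsilon> * (2 * Fbar * (f (x m) - fstar) / (\<eta> * lim r))"
proof -
  define K where "K = \<eta> * lim r / (2 * Fbar)"
  have K: "K > 0"
    using \<eta> r_lim[OF D] Fbar_pos by (simp add: K_def)
  have "real n * (K * \<epsilon>) \<le> f (x m) - f (x (m + n))"
    using large
  proof (induction n)
    case (Suc n)
    have "r (m + n) \<le> Fstar / (L * \<eta>)"
      using small decseqD[OF r_decseq, of m "m + n"] by linarith
    then have "K * g (m + n) \<le> f (x (m + n)) - f (x (m + Suc n))"
      using f_decrease[OF D] by (simp add: K_def)
    moreover have "K * \<epsilon> \<le> K * g (m + n)"
      using Suc.prems[of "m + n"] K by (intro mult_left_mono) auto
    ultimately show ?case
      using Suc by (simp add: algebra_simps)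
  qed simp
  also have "\<dots> \<le> f (x m) - fstar"
    using fstar_le by simp
  finally have "real n \<le> (f (x m) - fstar) / (K * \<epsilon>)"
    using K \<epsilon> by (simp add: pos_le_divide_eq)
  then show ?thesis
    by (simp add: K_def field_simps)
qed

section \<open>Decay of \<open>r\<close> while the gradients are large\<close>

text \<open>\<open>F (s 0) \<le> Fbar\<close> and \<open>F\<close> is unbounded, so
  \<open>Fbar\<close> is in the range and the default value of \<open>pos_inverse\<close> does not
  occur.\<close>

lemma Fbar_attained: "0 < pos_inverse F Fbar" "F (pos_inverse F Fbar) = Fbar"
proof -
  have "\<forall>\<^sub>F t in at_top. Fbar \<le> F t \<and> s 0 \<le> t"
    using F_lim by (auto simp: filterlim_at_top eventually_conj_iff)
  then obtain t where "Fbar \<le> F t" "s 0 \<le> t"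
    using eventually_happens trivial_limit_at_top_linorder by blast
  moreover have "continuous_on {s 0..t} F"
    using s_pos[of 0] by (intro continuous_on_subset[OF smooth_on_imp_continuous_on[OF F_smooth]]) auto
  ultimately obtain u where u: "s 0 \<le> u" "F u = Fbar"
    using IVT'[of F "s 0" Fbar t] F_s_le_Fbar[of 0] by auto
  then have "u > 0"
    using s_pos[of 0] by linarith
  then have "pos_inverse F Fbar = u"
    using u by (intro pos_inverse_eq strict_mono_on_imp_inj_on F_mono)
  then show "0 < pos_inverse F Fbar" "F (pos_inverse F Fbar) = Fbar"
    using u \<open>u > 0\<close> by auto
qed

lemma s_le_Fbar_inverse: "s k \<le> pos_inverse F Fbar"
  using F_le_iff[OF s_pos[of k] Fbar_attained(1)] F_s_le_Fbar[of k] Fbar_attained(2) by simp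

text \<open>Since \<open>s k\<close> never exceeds \<open>pos_inverse F Fbar\<close>, the quotient
  of \<open>deriv F\<close> and \<open>F\<close> at \<open>s k\<close> is at least
  \<open>\<alpha>\<close>, so each update with a large gradient divides \<open>r\<close> by at least
  \<open>1 + \<alpha> * \<eta> * \<epsilon>\<close>.\<close>

lemma r_geometric:
  assumes \<epsilon>: "\<epsilon> > 0" and \<alpha>: "\<alpha> = deriv F (pos_inverse F Fbar) / Fbar"
    and large: "\<And>j. j < k \<Longrightarrow> \<epsilon> \<le> g j"
  shows "r k * (1 + \<alpha> * \<eta> * \<epsilon>) ^ k \<le> r 0"
  using large
proof (induction k)
  case (Suc k)
  have \<alpha>0: "\<alpha> > 0"
    using F'_pos[OF Fbar_attained(1)] Fbar_pos by (simp add: \<alpha>)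
  have "\<alpha> \<le> deriv F (s k) / F (s k)"
    unfolding \<alpha> using F'_pos[OF s_pos, of k] F'_antimono[OF s_pos s_le_Fbar_inverse] F_s_pos F_s_le_Fbar
    by (intro frac_le) (auto intro: less_imp_le)
  then have "\<eta> * \<alpha> * \<epsilon> \<le> \<eta> * (deriv F (s k) / F (s k)) * g k"
    using \<eta> \<alpha>0 \<epsilon> Suc.prems[of k]
    by (intro mult_mono mult_nonneg_nonneg) (auto intro: order_trans[of 0 \<alpha>])
  then have "r (Suc k) * (1 + \<alpha> * \<eta> * \<epsilon>) \<le> r (Suc k) * (1 + \<eta> * (deriv F (s k) / F (s k)) * g k)"
    using r_pos[of "Suc k"] by (intro mult_left_mono) (auto simp: mult_ac)
  also have "\<dots> = r k"
    using r_Suc[of k] rate_nonneg[of k] by simp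
  finally have "r (Suc k) * (1 + \<alpha> * \<eta> * \<epsilon>) * (1 + \<alpha> * \<eta> * \<epsilon>) ^ k \<le> r k * (1 + \<alpha> * \<eta> * \<epsilon>) ^ k"
    using \<alpha>0 \<eta> \<epsilon> by (intro mult_right_mono) auto
  also have "\<dots> \<le> r 0"
    using Suc by simp
  finally show ?case
    by (simp add: mult_ac)
qed simp

section \<open>The two iteration bounds\<close>

lemma small_gradient_of_small_r:
  assumes D: "f (x 0) > fstar" and small: "r 0 \<le> Fstar / (L * \<eta>)" and \<epsilon>: "\<epsilon> > 0"
    and N: "1 / \<epsilon> * (2 * Fbar * (f (x 0) - fstar) / (\<eta> * lim r)) \<le> real N"
  shows "\<exists>k\<le>N. g k < \<epsilon>"
proof (rule ccontr)
  assume "\<not> ?thesis"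
  \<comment> \<open>The indices from 0 to \<open>N\<close> would be \<open>Suc N\<close> large
    gradients, one more than the bound permits.\<close>
  then have "real (Suc N) \<le> 1 / \<epsilon> * (2 * Fbar * (f (x 0) - fstar) / (\<eta> * lim r))"
    by (intro count_large_gradients[OF D small \<epsilon>]) (auto simp: not_less less_Suc_eq_le)
  with N show False by simp
qed

text \<open>If all gradients up to \<open>N\<close> were large, the first \<open>m\<close> steps
  would bring \<open>r\<close> below the threshold; counting then starts at \<open>m\<close>, with
  \<open>fbar\<close> bounding the value of \<open>f\<close> reached there.\<close>

lemma small_gradient_of_large_r:
  assumes D: "f (x 0) > fstar" and big: "r 0 > Fstar / (L * \<eta>)" and \<epsilon>: "\<epsilon> > 0"
    and fbar: "fbar = pos_inverse F Fbar - c" and \<alpha>: "\<alpha> = deriv F (pos_inverse F Fbar) / Fbar"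
    and N: "max (ln (L * r 0 * \<eta> / Fstar) / ln (1 + \<alpha> * \<eta> * \<epsilon>)) 1
      + 1 / \<epsilon> * (2 * Fbar * (fbar - fstar) / (\<eta> * lim r)) \<le> real N"
  shows "\<exists>k\<le>N. g k < \<epsilon>"
proof (rule ccontr)
  assume "\<not> ?thesis"
  then have large: "\<epsilon> \<le> g k" if "k \<le> N" for k
    using that by (meson not_less)
  define T where "T = ln (L * r 0 * \<eta> / Fstar) / ln (1 + \<alpha> * \<eta> * \<epsilon>)"
  define m where "m = nat \<lceil>T\<rceil>"
  define K where "K y = 1 / \<epsilon> * (2 * Fbar * (y - fstar) / (\<eta> * lim r))" for y
  have "\<alpha> > 0"
    using F'_pos[OF Fbar_attained(1)] Fbar_pos by (simp add: \<alpha>)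
  then have q: "1 < 1 + \<alpha> * \<eta> * \<epsilon>"
    using \<eta> \<epsilon> by simp
  have Q: "1 < L * r 0 * \<eta> / Fstar"
    using big Fstar_pos L \<eta> by (simp add: field_simps)
  then have "T > 0"
    using q by (simp add: T_def)
  then have m: "T \<le> real m" "real m < T + 1"
    unfolding m_def by linarith+
  have K_mono: "K y \<le> K z" if "y \<le> z" for y z
    unfolding K_def using that \<epsilon> \<eta> Fbar_pos r_lim(1)[OF D]
    by (intro mult_left_mono divide_right_mono) auto
  have "0 \<le> K fstar"
    by (simp add: K_def)
  also have "K fstar \<le> K (f (x m))"
    by (intro K_mono fstar_le)
  also have "\<dots> \<le> K fbar"
    using s_le_Fbar_inverse[of m] by (intro K_mono) (simp add: fbar)
  finally have Kbar: "0 \<le> K fbar" "K (f (x m)) \<le> K fbar"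
    using K_mono s_le_Fbar_inverse[of m] by (auto simp: fbar)
  have N': "T + K fbar \<le> real N"
    using N unfolding T_def K_def by linarith
  \<comment> \<open>Hence all indices below \<open>m\<close> are at most \<open>N\<close>, and
    \<open>r_geometric\<close> applies to them.\<close>
  then have "m \<le> Suc N"
    using m Kbar by linarith
  have "ln (L * r 0 * \<eta> / Fstar) = T * ln (1 + \<alpha> * \<eta> * \<epsilon>)"
    using ln_gt_zero[OF q] by (simp add: T_def del: ln_gt_zero_iff)
  also have "\<dots> \<le> real m * ln (1 + \<alpha> * \<eta> * \<epsilon>)"
    using m q by (intro mult_right_mono) auto
  also have "\<dots> = ln ((1 + \<alpha> * \<eta> * \<epsilon>) ^ m)"
    using q by (simp add: ln_realpow)
  finally have "L * r 0 * \<eta> / Fstar \<le> (1 + \<alpha> * \<eta> * \<epsilon>) ^ m"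
    using Q q by (subst (asm) ln_le_cancel_iff) auto
  then have "r m * (L * r 0 * \<eta> / Fstar) \<le> r m * (1 + \<alpha> * \<eta> * \<epsilon>) ^ m"
    using r_pos[of m] by (intro mult_left_mono) auto
  also have "\<dots> \<le> r 0"
    using \<open>m \<le> Suc N\<close> by (intro r_geometric \<epsilon> \<alpha> large) simp
  finally have "r m \<le> Fstar / (L * \<eta>)"
    using r0 L \<eta> Fstar_pos by (simp add: field_simps)
  then have "real (Suc N - m) \<le> K (f (x m))"
    unfolding K_def by (rule count_large_gradients[OF D _ \<epsilon>]) (auto intro!: large)
  \<comment> \<open>The \<open>Suc N - m\<close> indices from \<open>m\<close> to \<open>N\<close>
    number at most \<open>N - T\<close>, forcing \<open>T + 1 \<le> m\<close>; the extra index at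
    \<open>N\<close> thus absorbs the rounding up of \<open>T\<close>.\<close>
  then show False
    using N' m Kbar \<open>m \<le> Suc N\<close> by (simp add: of_nat_diff)
qed

end

theorem theorem3p6:
  fixes f :: "real ^ 'd \<Rightarrow> real" and F :: "real \<Rightarrow> real"
    and x :: "nat \<Rightarrow> real ^ 'd" and r :: "nat \<Rightarrow> real"
    and L \<eta> c \<epsilon> fstar rstar Fstar Fbar fbar Fbar' \<alpha> :: real
  assumes L: "L > 0" and f: "f \<in> C11 L" and f_bdd: "bdd_below (range f)"
    and F_pos: "F \<in> {0<..} \<rightarrow> {0<..}" and F_smooth: "smooth_on {0<..} F"
    and F_mono: "strict_mono_on {0<..} F" and F_lim: "filterlim F at_top at_top"
    and F_concave: "strictly_concave_on {0<..} F" and F'_lim: "(deriv F \<longlongrightarrow> 0) at_top"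
    and \<eta>: "\<eta> > 0" and r0: "r 0 > 0"
    and fstar: "fstar = (INF y. f y)" and c_pos: "fstar + c > 0"
    and c: "c \<ge> c_star f F L \<eta> (r 0) (x 0)"
    and iter: "gAEGD f F \<eta> c x r"
    and rstar: "rstar = lim r"
    and Fstar: "Fstar = F (fstar + c)"
    and Fbar: "Fbar = F (f (x 0) + c) + L * \<eta> * (r 0)\<^sup>2 / (4 * Fstar)"
    and fbar: "fbar = pos_inverse F Fbar - c"
    and Fbar': "Fbar' = deriv F (fbar + c)"
    and \<alpha>: "\<alpha> = Fbar' / Fbar"
    and \<epsilon>: "\<epsilon> > 0"
  shows "(r 0 \<le> Fstar / (L * \<eta>) \<longrightarrow>
           (MIN k\<in>{..nat \<lceil>1 / \<epsilon> * (2 * Fbar * (f (x 0) - fstar) / (\<eta> * rstar))\<rceil>}.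
              (norm (grad f (x k)))\<^sup>2) < \<epsilon>) \<and>
         (r 0 > Fstar / (L * \<eta>) \<longrightarrow>
           (MIN k\<in>{..nat \<lceil>max (ln (L * r 0 * \<eta> / Fstar) / ln (1 + \<alpha> * \<eta> * \<epsilon>)) 1
                          + 1 / \<epsilon> * (2 * Fbar * (fbar - fstar) / (\<eta> * rstar))\<rceil>}.
              (norm (grad f (x k)))\<^sup>2) < \<epsilon>)"
proof -
  interpret gAEGD_run f F x r L \<eta> c fstar Fstar Fbar
    using assms by unfold_locales
  have Min_lessI: "(MIN k\<in>{..N}. g k) < \<epsilon>" if "\<exists>k\<le>N. g k < \<epsilon>" for N
    using that by (subst Min_less_iff) auto
  show ?thesis
  proof (cases "f (x 0) = fstar")
    case True
    then have "grad f (x 0) = 0"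
      using C11_grad_eq_0_at_min[OF f L] fstar_le by metis
    \<comment> \<open>Index 0 belongs to every range, so the bound holds whatever the value of
      \<open>lim r\<close> in \<open>N\<close>.\<close>
    then have "\<exists>k\<le>N. g k < \<epsilon>" for N
      using \<epsilon> by (intro exI[of _ 0]) simp
    then show ?thesis
      using Min_lessI by blast
  next
    case False
    then have D: "f (x 0) > fstar"
      using fstar_le[of "x 0"] by linarith
    have "\<alpha> = deriv F (pos_inverse F Fbar) / Fbar"
      by (simp add: \<alpha> Fbar' fbar)
    then show ?thesis
      unfolding rstar
      using small_gradient_of_small_r[OF D _ \<epsilon> real_nat_ceiling_ge]
        small_gradient_of_large_r[OF D _ \<epsilon> fbar _ real_nat_ceiling_ge]
      by (intro conjI impI Min_lessI)
  qed
qed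

end
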